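(* Let $p$ be a prime, let $n,N,q\ge 1$, let $A\in\mathbb{F}_p^{n\times n}$ and $b\in\mathbb{F}_p^{n\times 1}$, and let $\mathcal{G}_1,\dots,\mathcal{G}_q$ be weighted directed graphs on the vertices $\{0,1,\dots,N\}$ (leader $0$, followers $1,\dots,N$), where $\mathcal{G}_r$ has weights $a^{(r)}_{ij}\in\mathbb{F}_p$. Let $\bar{\mathcal{G}}_r$ be the subgraph of $\mathcal{G}_r$ induced by $\{1,\dots,N\}$. Suppose that $A$ is not nilpotent, that $(A,b)$ is stabilizable, and let $d\in\{1,\dots,p-1\}$. Then there is a constant matrix $K\in\mathbb{F}_p^{1\times n}$ such that, for every switching signal $\sigma:\{0,1,2,\dots\}\to\{1,\dots,q\}$ for which - the union $\bigcup_{k\ge 1}\bar{\mathcal{G}}_{\sigma(k)}$ is a directed acyclic graph, and - the in-degrees $d_i^k=\sum_{j=0}^N a^{(\sigma(k))}_{ij}$ satisfy $d_i^k=d$ in $\mathbb{F}_p$ for every $i=1,\dots,N$ and every $k$, the followers $$x_i(k+1)=Ax_i(k)+bu_i(k),\qquad i=1,\dots,N,$$ with control $$u_i(k)=K\sum_{j=0}^N a^{(\sigma(k))}_{ij}\,(x_j(k)-x_i(k))$$ achieve consensus with the leader $x_0(k+1)=Ax_0(k)$.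
   Context: $\mathbb{F}_p=\mathbb{Z}/p\mathbb{Z}=\{0,1,\dots,p-1\}$ is the finite field with $p$ elements, $p$ prime; all arithmetic is in $\mathbb{F}_p$. States and inputs: $x_i(k)\in\mathbb{F}_p^{n\times 1}$ for $i=0,\dots,N$ and $u_i(k)\in\mathbb{F}_p$; time $k=0,1,2,\dots$ is discrete. Graphs: in each directed graph $\mathcal{G}_r$, an edge $(j,i)$ means that agent $i$ receives information from agent $j$; the weights satisfy $a^{(r)}_{ij}=0$ if $(j,i)$ is not an edge of $\mathcal{G}_r$. The in-degree $d_i^k$ is computed in $\mathbb{F}_p$ and includes the weight from the leader. The union of a set of directed graphs is the directed graph whose vertex set and edge set are the unions of the vertex sets and of the edge sets. A directed acyclic graph is a directed graph without directed cycles (in particular without self-loops). The switching signal $\sigma$ gives the graph $\mathcal{G}_{\sigma(k)}$ in force at time $k$. Consensus: the followers achieve consensus with the leader if for any initial states $x_0(0),x_1(0),\dots,x_N(0)\in\mathbb{F}_p^n$ there exists a positive integer $T$ such that $x_i(k)=x_0(k)$ for all $i=1,\dots,N$ and all $k\ge T$. Nilpotent: a square matrix $M$ over $\mathbb{F}_p$ is nilpotent if $M^k=\mathbf{0}$ for some positive integer $k$. Stabilizable: for any pair $(A,b)$ over $\mathbb{F}_p$ there is an invertible $Q\in\mathbb{F}_p^{n\times n}$ such that $$QAQ^{-1}=\begin{pmatrix}A^c & A^{cc}\\ \mathbf{0}& A^{uc}\end{pmatrix},\qquad Qb=\begin{pmatrix}b^c\\ \mathbf{0}\end{pmatrix},$$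 where $A^c$ is $\bar n\times\bar n$ with $\bar n=\operatorname{rank}[b,Ab,\dots,A^{n-1}b]$, and $(A^c,b^c)$ is controllable (i.e. $[b^c,A^cb^c,\dots,(A^c)^{\bar n-1}b^c]$ has rank $\bar n$) and in control companion form. The pair $(A,b)$ is called stabilizable if the uncontrollable subsystem matrix $A^{uc}$ is nilpotent (this includes the case $\bar n=n$, in which the block $A^{uc}$ is empty). Equivalently, $(A,b)$ is stabilizable if and only if there is $K\in\mathbb{F}_p^{1\times n}$ such that $A+bK$ is nilpotent. *)

theory Defs
  imports
    "Berlekamp_Zassenhaus.Finite_Field"
    "Jordan_Normal_Form.DL_Rank"
    "Graph_Theory.Graph_Theory"
begin

text \<open>
  The field with \<open>p\<close> elements is \<open>'p mod_ring\<close> for \<open>'p :: prime_card\<close>, with \<open>p = CARD('p)\<close>.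
  Columns are vectors of type \<open>'a vec\<close>; a row such as the feedback gain is a \<open>1 \<times> n\<close> matrix, and a
  \<open>1 \<times> 1\<close> product is read as a scalar by taking entry \<open>0\<close>. Matrix and vector indices start at \<open>0\<close>.
\<close>

subsection \<open>Nilpotent matrices and stabilizable pairs\<close>

definition nilpotent_mat :: "'a :: semiring_1 mat \<Rightarrow> bool" where
  "nilpotent_mat M \<longleftrightarrow> square_mat M \<and> (\<exists>k>0. M ^\<^sub>m k = 0\<^sub>m (dim_row M) (dim_row M))"

definition controllability_mat :: "nat \<Rightarrow> 'a :: field mat \<Rightarrow> 'a vec \<Rightarrow> 'a mat" where
  "controllability_mat n A b = mat_of_cols n (map (\<lambda>k. A ^\<^sub>m k *\<^sub>v b) [0..<n])"

definition controllable :: "nat \<Rightarrow> 'a :: field mat \<Rightarrow> 'a vec \<Rightarrow> bool" where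
  "controllable n A b \<longleftrightarrow> vec_space.rank n (controllability_mat n A b) = n"

text \<open>
  Ones on the superdiagonal, arbitrary last row, zeros elsewhere; the input vector is the last
  standard basis vector.
\<close>

definition control_companion_form :: "nat \<Rightarrow> 'a :: field mat \<Rightarrow> 'a vec \<Rightarrow> bool" where
  "control_companion_form n A b \<longleftrightarrow>
     (\<exists>\<alpha>. A = mat n n (\<lambda>(i, j). if i = n - 1 then \<alpha> j else if j = i + 1 then 1 else 0)) \<and>
     b = vec n (\<lambda>i. if i = n - 1 then 1 else 0)"

text \<open>
  The condition \<open>similar_mat_wit M A Q Q'\<close> says that \<open>Q'\<close> is the inverse of \<open>Q\<close> and \<open>M = Q * A * Q'\<close>.
\<close>

definition stabilizable :: "nat \<Rightarrow> 'a :: field mat \<Rightarrow> 'a vec \<Rightarrow> bool" where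
  "stabilizable n A b \<longleftrightarrow>
     (let m = vec_space.rank n (controllability_mat n A b) in
      \<exists>Q Q' Ac Acc Auc bc.
        Ac \<in> carrier_mat m m \<and> Acc \<in> carrier_mat m (n - m) \<and>
        Auc \<in> carrier_mat (n - m) (n - m) \<and> bc \<in> carrier_vec m \<and>
        similar_mat_wit (four_block_mat Ac Acc (0\<^sub>m (n - m) m) Auc) A Q Q' \<and>
        Q *\<^sub>v b = bc @\<^sub>v 0\<^sub>v (n - m) \<and>
        controllable m Ac bc \<and> control_companion_form m Ac bc \<and>
        nilpotent_mat Auc)"

subsection \<open>Graphs\<close>

definition directed_acyclic :: "('v, 'e) pre_digraph \<Rightarrow> bool" where
  "directed_acyclic G \<longleftrightarrow> wf_digraph G \<and> (\<nexists>c. pre_digraph.cycle G c)"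

text \<open>
  Agent \<open>0\<close> is the leader. An arc \<open>(j, i)\<close> means that \<open>i\<close> receives information from \<open>j\<close>, and
  \<open>w i j\<close> is its weight.
\<close>

definition weighted_digraph_on ::
    "nat \<Rightarrow> nat pair_pre_digraph \<Rightarrow> (nat \<Rightarrow> nat \<Rightarrow> 'a :: zero) \<Rightarrow> bool" where
  "weighted_digraph_on N G w \<longleftrightarrow>
     pair_wf_digraph G \<and> pverts G = {0..N} \<and>
     (\<forall>i\<in>{0..N}. \<forall>j\<in>{0..N}. (j, i) \<notin> parcs G \<longrightarrow> w i j = 0)"

definition follower_graph :: "nat \<Rightarrow> nat pair_pre_digraph \<Rightarrow> (nat, nat \<times> nat) pre_digraph" where
  "follower_graph N G = with_proj G \<restriction> {1..N}"

text \<open>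
  The first argument of \<^const>\<open>pre_digraph.Union\<close> only supplies the tail and head maps, which are
  \<open>fst\<close> and \<open>snd\<close> for all graphs involved.
\<close>

definition follower_union ::
    "nat \<Rightarrow> (nat \<Rightarrow> nat pair_pre_digraph) \<Rightarrow> (nat \<Rightarrow> nat) \<Rightarrow> (nat, nat \<times> nat) pre_digraph" where
  "follower_union N G \<sigma> =
     pre_digraph.Union (follower_graph N (G (\<sigma> 1))) ((\<lambda>k. follower_graph N (G (\<sigma> k))) ` {1..})"

subsection \<open>Leader-follower dynamics\<close>

text \<open>
  \<open>x i k\<close> and \<open>u i k\<close> are state and input of agent \<open>i\<close> at time \<open>k\<close>; \<open>w k i j\<close> are the weights in
  force at time \<open>k\<close>.
\<close>

definition leader_follower_system ::
    "nat \<Rightarrow> nat \<Rightarrow> 'a :: field mat \<Rightarrow> 'a vec \<Rightarrow> (nat \<Rightarrow> nat \<Rightarrow> 'a vec) \<Rightarrow> (nat \<Rightarrow> nat \<Rightarrow> 'a) \<Rightarrow> bool"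
  where
  "leader_follower_system n N A b x u \<longleftrightarrow>
     (\<forall>i\<in>{0..N}. x i 0 \<in> carrier_vec n) \<and>
     (\<forall>k. x 0 (k + 1) = A *\<^sub>v x 0 k) \<and>
     (\<forall>i\<in>{1..N}. \<forall>k. x i (k + 1) = A *\<^sub>v x i k + u i k \<cdot>\<^sub>v b)"

definition consensus_control ::
    "nat \<Rightarrow> nat \<Rightarrow> 'a :: field mat \<Rightarrow> (nat \<Rightarrow> nat \<Rightarrow> nat \<Rightarrow> 'a) \<Rightarrow>
     (nat \<Rightarrow> nat \<Rightarrow> 'a vec) \<Rightarrow> (nat \<Rightarrow> nat \<Rightarrow> 'a) \<Rightarrow> bool" where
  "consensus_control n N K w x u \<longleftrightarrow>
     (\<forall>i\<in>{1..N}. \<forall>k.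
        u i k = (K *\<^sub>v finsum_vec TYPE('a) n (\<lambda>j. w k i j \<cdot>\<^sub>v (x j k - x i k)) {0..N}) $ 0)"

text \<open>
  A solution is determined by its initial states, so quantifying over all solutions is quantifying
  over all initial states.
\<close>

definition achieves_consensus ::
    "nat \<Rightarrow> nat \<Rightarrow> 'a :: field mat \<Rightarrow> 'a vec \<Rightarrow> 'a mat \<Rightarrow> (nat \<Rightarrow> nat \<Rightarrow> nat \<Rightarrow> 'a) \<Rightarrow> bool" where
  "achieves_consensus n N A b K w \<longleftrightarrow>
     (\<forall>x u. leader_follower_system n N A b x u \<and> consensus_control n N K w x u \<longrightarrow>
        (\<exists>T>0. \<forall>i\<in>{1..N}. \<forall>k\<ge>T. x i k = x 0 k))"

end

theory Submission
  imports Defs "Jordan_Normal_Form.Jordan_Normal_Form"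
begin

text \<open>
  Stabilizability provides a gain \<open>K\<close> for which \<open>A + b K\<close> is nilpotent
  (\<open>stabilizable_imp_nilpotent_feedback\<close>): in the coordinates of the controllable decomposition a
  row feedback turns the companion block into a shift, while the uncontrollable block is nilpotent
  by hypothesis, and a block triangular matrix with nilpotent diagonal blocks is nilpotent.

  The agents use the gain \<open>- K / d\<close>, which does not depend on the graphs or on the switching. Let
  \<open>e\<^sub>i = x\<^sub>i - x\<^sub>0\<close>. Since the weights at agent \<open>i\<close> add up to \<open>d\<close>, its error satisfies
  \<open>e\<^sub>i(k+1) = (A + b K) e\<^sub>i(k) - (1/d) b K \<Sum>\<^sub>j a\<^sub>i\<^sub>j e\<^sub>j(k)\<close>, where \<open>j\<close> ranges over the followers
  that \<open>i\<close> listens to. An acyclic union of the follower graphs is a finite acyclic relation, hence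
  well-founded, and it contains every arc between followers in use from time \<open>1\<close> on. By induction along this relation all
  errors \<open>e\<^sub>j\<close> in the sum are eventually zero, from then on \<open>e\<^sub>i\<close> is multiplied by a fixed nilpotent
  matrix at each step, and so it vanishes as well (\<open>error_step\<close>, \<open>consensus_of_wf\<close>).
\<close>

section \<open>Nilpotent matrices\<close>

lemma pow_mat_add:
  assumes A: "A \<in> carrier_mat n n"
  shows "A ^\<^sub>m (k + l) = A ^\<^sub>m k * A ^\<^sub>m l"
proof (induction l)
  case (Suc l)
  have "A ^\<^sub>m (k + Suc l) = A ^\<^sub>m k * A ^\<^sub>m l * A"
    by (simp add: Suc.IH)
  also have "\<dots> = A ^\<^sub>m k * A ^\<^sub>m Suc l"
    unfolding pow_mat.simps
    by (rule assoc_mult_mat[OF pow_carrier_mat[OF A] pow_carrier_mat[OF A] A])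
  finally show ?case .
qed (use A in simp)

lemma nilpotent_mat_eventually_zero:
  assumes M: "M \<in> carrier_mat n n" and "nilpotent_mat M"
  obtains h where "h > 0" and "\<And>k. k \<ge> h \<Longrightarrow> M ^\<^sub>m k = 0\<^sub>m n n"
proof -
  obtain h where h: "h > 0" "M ^\<^sub>m h = 0\<^sub>m n n"
    using assms unfolding nilpotent_mat_def by auto
  have "M ^\<^sub>m k = 0\<^sub>m n n" if "k \<ge> h" for k
  proof -
    have "M ^\<^sub>m k = M ^\<^sub>m h * M ^\<^sub>m (k - h)"
      using that by (simp flip: pow_mat_add[OF M])
    then show ?thesis using h M by simp
  qed
  with h(1) show thesis by (rule that)
qed

lemma pow_four_block_upper_triangular:
  assumes B: "B \<in> carrier_mat m m" and C: "C \<in> carrier_mat m l" and D: "D \<in> carrier_mat l l"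
  shows "\<exists>X \<in> carrier_mat m l.
    four_block_mat B C (0\<^sub>m l m) D ^\<^sub>m k = four_block_mat (B ^\<^sub>m k) X (0\<^sub>m l m) (D ^\<^sub>m k)"
proof (induction k)
  case 0
  show ?case
    using assms by (intro bexI[of _ "0\<^sub>m m l"]) auto
next
  case (Suc k)
  then obtain X where X: "X \<in> carrier_mat m l"
    and IH: "four_block_mat B C (0\<^sub>m l m) D ^\<^sub>m k = four_block_mat (B ^\<^sub>m k) X (0\<^sub>m l m) (D ^\<^sub>m k)"
    by blast
  have Bk: "B ^\<^sub>m k \<in> carrier_mat m m" and Dk: "D ^\<^sub>m k \<in> carrier_mat l l"
    using B D by auto
  have z: "0\<^sub>m l m \<in> carrier_mat l m" by simp
  have "four_block_mat B C (0\<^sub>m l m) D ^\<^sub>m Suc k =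
      four_block_mat (B ^\<^sub>m Suc k) (B ^\<^sub>m k * C + X * D) (0\<^sub>m l m) (D ^\<^sub>m Suc k)"
  proof -
    have "B ^\<^sub>m k * B + X * 0\<^sub>m l m = B ^\<^sub>m Suc k"
      using X mult_carrier_mat[OF Bk B] by simp
    moreover have "0\<^sub>m l m * B + D ^\<^sub>m k * 0\<^sub>m l m = 0\<^sub>m l m"
      using B right_mult_zero_mat[OF Dk] by simp
    moreover have "0\<^sub>m l m * C + D ^\<^sub>m k * D = D ^\<^sub>m Suc k"
      using C mult_carrier_mat[OF Dk D] by simp
    ultimately show ?thesis
      using mult_four_block_mat[OF Bk X z Dk B C z D] IH by simp
  qed
  moreover have "B ^\<^sub>m k * C + X * D \<in> carrier_mat m l"
    using X Bk C D by auto
  ultimately show ?case by blast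
qed

text \<open>
  Once the diagonal blocks of a power vanish, only the corner block is left, and it squares to zero.
\<close>

lemma nilpotent_four_block_upper_triangular:
  assumes B: "B \<in> carrier_mat m m" and C: "C \<in> carrier_mat m l" and D: "D \<in> carrier_mat l l"
    and nB: "nilpotent_mat B" and nD: "nilpotent_mat D"
  shows "nilpotent_mat (four_block_mat B C (0\<^sub>m l m) D)"
proof -
  let ?M = "four_block_mat B C (0\<^sub>m l m) D"
  have M: "?M \<in> carrier_mat (m + l) (m + l)" using B D by auto
  obtain h1 where h1: "h1 > 0" "\<And>k. k \<ge> h1 \<Longrightarrow> B ^\<^sub>m k = 0\<^sub>m m m"
    using nilpotent_mat_eventually_zero[OF B nB] by metis
  obtain h2 where h2: "h2 > 0" "\<And>k. k \<ge> h2 \<Longrightarrow> D ^\<^sub>m k = 0\<^sub>m l l"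
    using nilpotent_mat_eventually_zero[OF D nD] by metis
  define h where "h = max h1 h2"
  obtain X where X: "X \<in> carrier_mat m l"
    and "?M ^\<^sub>m h = four_block_mat (B ^\<^sub>m h) X (0\<^sub>m l m) (D ^\<^sub>m h)"
    using pow_four_block_upper_triangular[OF B C D] by blast
  then have Mh: "?M ^\<^sub>m h = four_block_mat (0\<^sub>m m m) X (0\<^sub>m l m) (0\<^sub>m l l)"
    using h1 h2 by (simp add: h_def)
  have "?M ^\<^sub>m (h + h) = ?M ^\<^sub>m h * ?M ^\<^sub>m h"
    by (rule pow_mat_add[OF M])
  also have "\<dots> = 0\<^sub>m (m + l) (m + l)"
    unfolding Mh using X
    by (subst mult_four_block_mat[of _ m m _ l _ l _ _ m _ l]) auto
  finally have "?M ^\<^sub>m (h + h) = 0\<^sub>m (m + l) (m + l)" .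
  moreover have "h + h > 0" using h1(1) by (simp add: h_def)
  ultimately show ?thesis
    using M unfolding nilpotent_mat_def by (metis carrier_matD square_mat.simps)
qed

lemma nilpotent_mat_similar:
  assumes sim: "similar_mat_wit B A P Q" and nil: "nilpotent_mat B"
  shows "nilpotent_mat A"
proof -
  define n where "n = dim_row B"
  note BD = similar_mat_witD[OF n_def sim]
  obtain k where k: "k > 0" "B ^\<^sub>m k = 0\<^sub>m n n"
    using nil unfolding nilpotent_mat_def n_def by auto
  have "A ^\<^sub>m k = Q * B ^\<^sub>m k * P"
    by (rule similar_mat_wit_pow_id[OF similar_mat_wit_sym[OF sim]])
  also have "\<dots> = 0\<^sub>m n n"
    using k(2) BD by simp
  finally show ?thesis
    using k(1) BD(5) unfolding nilpotent_mat_def by auto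
qed

lemma nilpotent_jordan_block_zero: "nilpotent_mat (jordan_block n (0 :: 'a :: field))"
proof -
  have "jordan_block n (0 :: 'a) ^\<^sub>m Suc n = 0\<^sub>m n n"
    unfolding jordan_block_zero_pow by (intro eq_matI) auto
  then show ?thesis
    unfolding nilpotent_mat_def by (auto intro!: exI[of _ "Suc n"])
qed

section \<open>Nilpotent feedback for a stabilizable pair\<close>

text \<open>
  The contribution of the feedback to the closed loop is a column times a row, so the vector \<open>b\<close>
  has to be turned into an \<open>n \<times> 1\<close> matrix; applying the product to a state gives \<open>b\<close> scaled by the
  input.
\<close>

abbreviation outer :: "'a :: field vec \<Rightarrow> 'a mat \<Rightarrow> 'a mat" (infixl \<open>\<otimes>\<^sub>v\<close> 70) where
  "b \<otimes>\<^sub>v K \<equiv> mat_of_cols (dim_vec b) [b] * K"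

lemma outer_index:
  assumes "K \<in> carrier_mat 1 n" "i < dim_vec b" "j < n"
  shows "(b \<otimes>\<^sub>v K) $$ (i, j) = b $ i * K $$ (0, j)"
  using assms by (simp add: scalar_prod_def mat_of_cols_index)

lemma outer_mult_vec:
  assumes K: "K \<in> carrier_mat 1 n" and v: "v \<in> carrier_vec n"
  shows "(b \<otimes>\<^sub>v K) *\<^sub>v v = (K *\<^sub>v v) $ 0 \<cdot>\<^sub>v b"
proof -
  have "mat_of_cols (dim_vec b) [b] \<in> carrier_mat (dim_vec b) 1"
    by (simp add: carrier_matI)
  then have "(b \<otimes>\<^sub>v K) *\<^sub>v v = mat_of_cols (dim_vec b) [b] *\<^sub>v (K *\<^sub>v v)"
    using K v by (rule assoc_mult_mat_vec)
  also have "\<dots> = (K *\<^sub>v v) $ 0 \<cdot>\<^sub>v b"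
    using K by (intro eq_vecI) (auto simp: scalar_prod_def mat_of_cols_index mult.commute)
  finally show ?thesis .
qed

text \<open>
  A gain found in transformed coordinates is carried back to the original ones by composing it
  with the change of basis.
\<close>

lemma similar_feedback:
  assumes sim: "similar_mat_wit M A Q Q'" and A: "A \<in> carrier_mat n n"
    and b: "b \<in> carrier_vec n" and K: "K \<in> carrier_mat 1 n"
  shows "similar_mat_wit (M + (Q *\<^sub>v b) \<otimes>\<^sub>v K) (A + b \<otimes>\<^sub>v (K * Q)) Q Q'"
proof -
  let ?B = "mat_of_cols n [b]"
  note D = similar_mat_witD2[OF A similar_mat_wit_sym[OF sim]]
  have M: "M \<in> carrier_mat n n" and Q: "Q \<in> carrier_mat n n" and Q': "Q' \<in> carrier_mat n n"
    and QQ': "Q * Q' = 1\<^sub>m n" and Q'Q: "Q' * Q = 1\<^sub>m n"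
    using D by auto
  have MA: "M = Q * A * Q'"
    using similar_mat_witD2[OF M sim] by auto
  have B: "?B \<in> carrier_mat n 1" by (simp add: carrier_matI)
  have KQ: "K * Q \<in> carrier_mat 1 n" using K Q by simp
  have QB: "mat_of_cols n [Q *\<^sub>v b] = Q * ?B"
    using Q b by (intro eq_matI) (auto simp: mat_of_cols_index)
  have BKQ: "?B * (K * Q) \<in> carrier_mat n n" using B KQ by simp
  have dims: "dim_vec (Q *\<^sub>v b) = n" "dim_vec b = n" using Q b by auto
  have "Q * (?B * (K * Q)) * Q' = (Q * ?B) * K"
  proof -
    have QB_car: "Q * ?B \<in> carrier_mat n 1" using Q B by (rule mult_carrier_mat)
    then have QBK: "Q * ?B * K \<in> carrier_mat n n" using K by (rule mult_carrier_mat)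
    have "Q * (?B * (K * Q)) = Q * ?B * (K * Q)"
      by (rule assoc_mult_mat[OF Q B KQ, symmetric])
    also have "\<dots> = Q * ?B * K * Q"
      by (rule assoc_mult_mat[OF QB_car K Q, symmetric])
    finally have "Q * (?B * (K * Q)) * Q' = Q * ?B * K * (Q * Q')"
      using assoc_mult_mat[OF QBK Q Q'] by simp
    then show ?thesis using QQ' right_mult_one_mat[OF QBK] by simp
  qed
  then have "Q * (A + ?B * (K * Q)) * Q' = M + (Q * ?B) * K"
    unfolding mult_add_distrib_mat[OF Q A BKQ]
      add_mult_distrib_mat[OF mult_carrier_mat[OF Q A] mult_carrier_mat[OF Q BKQ] Q'] MA
    by simp
  then show ?thesis
    unfolding dims QB using QQ' Q'Q A BKQ Q Q' M B K
    by (intro similar_mat_witI[of _ _ n]) auto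
qed

text \<open>
  In companion coordinates the feedback cancels the last row of the controllable block and leaves
  the bare shift, which is the Jordan block with eigenvalue \<open>0\<close>. The uncontrollable block stays
  as it is, because the transformed input vector vanishes there; setting the gain to \<open>0\<close> on the
  uncontrollable coordinates keeps the corner block unchanged too.
\<close>

lemma stabilizable_imp_nilpotent_feedback:
  fixes A :: "'a :: field mat"
  assumes A: "A \<in> carrier_mat n n" and b: "b \<in> carrier_vec n" and stab: "stabilizable n A b"
  obtains K where "K \<in> carrier_mat 1 n" and "nilpotent_mat (A + b \<otimes>\<^sub>v K)"
proof -
  define m where "m = vec_space.rank n (controllability_mat n A b)"
  obtain Q Q' Ac Acc Auc bc where
    Ac: "Ac \<in> carrier_mat m m" and Acc: "Acc \<in> carrier_mat m (n - m)"
    and Auc: "Auc \<in> carrier_mat (n - m) (n - m)" and bc: "bc \<in> carrier_vec m"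
    and sim: "similar_mat_wit (four_block_mat Ac Acc (0\<^sub>m (n - m) m) Auc) A Q Q'"
    and Qb: "Q *\<^sub>v b = bc @\<^sub>v 0\<^sub>v (n - m)"
    and comp: "control_companion_form m Ac bc" and nil: "nilpotent_mat Auc"
    using stab unfolding stabilizable_def Let_def m_def[symmetric] by blast
  obtain \<alpha> where
    Ac_eq: "Ac = mat m m (\<lambda>(i, j). if i = m - 1 then \<alpha> j else if j = i + 1 then 1 else 0)"
    and bc_eq: "bc = vec m (\<lambda>i. if i = m - 1 then 1 else 0)"
    using comp unfolding control_companion_form_def by blast
  let ?M = "four_block_mat Ac Acc (0\<^sub>m (n - m) m) Auc"
  let ?J = "four_block_mat (jordan_block m 0) Acc (0\<^sub>m (n - m) m) Auc"
  have "dim_row ?M = n"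
    using similar_mat_witD2[OF A similar_mat_wit_sym[OF sim]] by auto
  then have n: "m + (n - m) = n" using Ac Auc by simp
  define k where "k = mat 1 n (\<lambda>(_, j). if j < m then - \<alpha> j else 0)"
  have k: "k \<in> carrier_mat 1 n" by (simp add: k_def)
  have dimQb: "dim_vec (Q *\<^sub>v b) = n"
    using Qb bc n by simp
  have "?M + (Q *\<^sub>v b) \<otimes>\<^sub>v k = ?J"
  proof (rule eq_matI)
    fix i j assume "i < dim_row ?J" "j < dim_col ?J"
    then have ij: "i < n" "j < n" using n Auc by auto
    have "((Q *\<^sub>v b) \<otimes>\<^sub>v k) $$ (i, j) = (Q *\<^sub>v b) $ i * k $$ (0, j)"
      using ij dimQb by (intro outer_index[OF k]) simp_all
    also have "\<dots> = (if i = m - 1 \<and> i < m \<and> j < m then - \<alpha> j else 0)"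
      using ij bc n unfolding Qb by (auto simp: k_def bc_eq)
    finally have "((Q *\<^sub>v b) \<otimes>\<^sub>v k) $$ (i, j) =
        (if i = m - 1 \<and> i < m \<and> j < m then - \<alpha> j else 0)" .
    then show "(?M + (Q *\<^sub>v b) \<otimes>\<^sub>v k) $$ (i, j) = ?J $$ (i, j)"
      using ij n Auc dimQb k by (auto simp: Ac_eq)
  qed (use n Auc dimQb k in auto)
  moreover have "nilpotent_mat ?J"
    using nilpotent_four_block_upper_triangular[OF _ Acc Auc nilpotent_jordan_block_zero nil]
    by simp
  ultimately have "nilpotent_mat (A + b \<otimes>\<^sub>v (k * Q))"
    using similar_feedback[OF sim A b k] nilpotent_mat_similar by metis
  moreover have "k * Q \<in> carrier_mat 1 n"
    using k similar_mat_witD2[OF A similar_mat_wit_sym[OF sim]] by simp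
  ultimately show thesis by (rule that[rotated])
qed

section \<open>Acyclicity as well-foundedness\<close>

text \<open>
  A closed chain of dominations is a closed walk, and every closed walk contains a cycle (a self-loop
  being a cycle of length \<open>1\<close>). Finiteness then upgrades acyclicity to an induction principle.
\<close>

lemma directed_acyclic_imp_wf:
  assumes "directed_acyclic H" and fin: "finite (arcs H)"
  shows "wf (arcs_ends H)"
proof -
  interpret wf_digraph H
    using assms(1) unfolding directed_acyclic_def by blast
  have "acyclic (arcs_ends H)"
  proof (rule acyclicI, intro allI notI)
    fix v assume "v \<rightarrow>\<^sup>+\<^bsub>H\<^esub> v"
    then obtain p where "awalk v p v" "p \<noteq> []"
      unfolding reachable1_awalk by blast
    then have "closed_w p" unfolding closed_w_def by auto
    then show False
      using closed_w_imp_cycle assms(1) unfolding directed_acyclic_def by blast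
  qed
  moreover have "finite (arcs_ends H)"
    using fin unfolding arcs_ends_def by simp
  ultimately show ?thesis by (intro finite_acyclic_wf)
qed

lemma arcs_follower_union:
  "arcs (follower_union N G \<sigma>) = (\<Union>k\<in>{1..}. parcs (G (\<sigma> k)) \<inter> {1..N} \<times> {1..N})"
  unfolding follower_union_def follower_graph_def pre_digraph.Union_def
  by (auto simp: induce_subgraph_def)

lemma arcs_ends_follower_union:
  "arcs_ends (follower_union N G \<sigma>) = arcs (follower_union N G \<sigma>)"
  unfolding arcs_ends_def
  by (simp add: follower_union_def follower_graph_def pre_digraph.Union_def arc_to_ends_def
      induce_subgraph_def)

section \<open>Error dynamics\<close>

lemma leader_follower_system_carrier:
  assumes sys: "leader_follower_system n N A b x u"
    and A: "A \<in> carrier_mat n n" and b: "b \<in> carrier_vec n" and i: "i \<in> {0..N}"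
  shows "x i k \<in> carrier_vec n"
proof (induction k)
  case 0
  then show ?case using sys i unfolding leader_follower_system_def by blast
next
  case (Suc k)
  show ?case
  proof (cases "i = 0")
    case True
    then have "x i (Suc k) = A *\<^sub>v x i k"
      using sys unfolding leader_follower_system_def by simp
    then show ?thesis using A Suc by simp
  next
    case False
    then have "x i (Suc k) = A *\<^sub>v x i k + u i k \<cdot>\<^sub>v b"
      using sys i unfolding leader_follower_system_def by simp
    then show ?thesis using A b Suc by simp
  qed
qed

text \<open>
  Terms of weight \<open>0\<close> do not count, and in every other term \<open>x\<^sub>j\<close> may be replaced by \<open>x\<^sub>0\<close>: it is
  as if the whole in-degree \<open>d\<close> came from the leader.
\<close>

lemma neighbour_sum_of_agreeing:
  fixes w :: "nat \<Rightarrow> 'a :: field" and x :: "nat \<Rightarrow> 'a vec"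
  assumes x: "\<And>j. j \<in> {0..N} \<Longrightarrow> x j \<in> carrier_vec n" and i: "i \<in> {0..N}"
    and deg: "(\<Sum>j = 0..N. w j) = d"
    and agree: "\<And>j. j \<in> {0..N} \<Longrightarrow> w j \<noteq> 0 \<Longrightarrow> x j = x 0"
  shows "finsum_vec TYPE('a) n (\<lambda>j. w j \<cdot>\<^sub>v (x j - x i)) {0..N} = (- d) \<cdot>\<^sub>v (x i - x 0)"
proof (rule eq_vecI)
  have car: "(\<lambda>j. w j \<cdot>\<^sub>v (x j - x i)) \<in> {0..N} \<rightarrow> carrier_vec n"
    using x i by auto
  have x0: "x 0 \<in> carrier_vec n" and xi: "x i \<in> carrier_vec n" using x i by auto
  show "dim_vec (finsum_vec TYPE('a) n (\<lambda>j. w j \<cdot>\<^sub>v (x j - x i)) {0..N}) =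
      dim_vec ((- d) \<cdot>\<^sub>v (x i - x 0))"
    using finsum_vec_closed[OF car] x0 by auto
  fix l assume "l < dim_vec ((- d) \<cdot>\<^sub>v (x i - x 0))"
  then have l: "l < n" using x0 by simp
  have "finsum_vec TYPE('a) n (\<lambda>j. w j \<cdot>\<^sub>v (x j - x i)) {0..N} $ l =
      (\<Sum>j = 0..N. (w j \<cdot>\<^sub>v (x j - x i)) $ l)"
    by (rule index_finsum_vec[OF _ l car]) simp
  also have "\<dots> = (\<Sum>j = 0..N. w j * (x 0 $ l - x i $ l))"
  proof (rule sum.cong[OF refl])
    fix j assume j: "j \<in> {0..N}"
    show "(w j \<cdot>\<^sub>v (x j - x i)) $ l = w j * (x 0 $ l - x i $ l)"
      using agree[OF j] x[OF j] xi l by (cases "w j = 0") auto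
  qed
  also have "\<dots> = ((- d) \<cdot>\<^sub>v (x i - x 0)) $ l"
    unfolding sum_distrib_right[symmetric] deg using x0 xi l by (simp add: algebra_simps)
  finally show "finsum_vec TYPE('a) n (\<lambda>j. w j \<cdot>\<^sub>v (x j - x i)) {0..N} $ l =
      ((- d) \<cdot>\<^sub>v (x i - x 0)) $ l" .
qed

text \<open>
  The factor \<open>- 1/d\<close> in the gain cancels the factor \<open>- d\<close> of the neighbour sum; what remains is the
  feedback \<open>K\<close> applied to the agent's own error.
\<close>

lemma error_step:
  fixes A :: "'a :: field mat"
  assumes A: "A \<in> carrier_mat n n" and b: "b \<in> carrier_vec n" and K: "K \<in> carrier_mat 1 n"
    and d: "d \<noteq> 0"
    and sys: "leader_follower_system n N A b x u"
    and ctrl: "consensus_control n N ((- inverse d) \<cdot>\<^sub>m K) w x u"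
    and i: "i \<in> {1..N}" and deg: "(\<Sum>j = 0..N. w k i j) = d"
    and agree: "\<And>j. j \<in> {0..N} \<Longrightarrow> w k i j \<noteq> 0 \<Longrightarrow> x j k = x 0 k"
  shows "x i (Suc k) - x 0 (Suc k) = (A + b \<otimes>\<^sub>v K) *\<^sub>v (x i k - x 0 k)"
proof -
  note car = leader_follower_system_carrier[OF sys A b]
  have i0: "i \<in> {0..N}" using i by simp
  have x0: "x 0 k \<in> carrier_vec n" and xi: "x i k \<in> carrier_vec n" using car i0 by auto
  let ?e = "x i k - x 0 k"
  have e: "?e \<in> carrier_vec n" using x0 xi by simp
  have "u i k = ((- inverse d) \<cdot>\<^sub>m K *\<^sub>v ((- d) \<cdot>\<^sub>v ?e)) $ 0"
    using ctrl i neighbour_sum_of_agreeing[of N "\<lambda>j. x j k" n i "w k i", OF car i0 deg agree]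
    unfolding consensus_control_def by simp
  also have "\<dots> = (K *\<^sub>v ?e) $ 0"
  proof -
    have "row K 0 \<in> carrier_vec n" using K by auto
    then show ?thesis
      using K e d smult_scalar_prod_distrib[of "row K 0" n "(- d) \<cdot>\<^sub>v ?e" "- inverse d"]
        scalar_prod_smult_distrib[of "row K 0" n ?e "- d"]
      by simp
  qed
  finally have u: "u i k = (K *\<^sub>v ?e) $ 0" .
  have bK: "b \<otimes>\<^sub>v K \<in> carrier_mat n n" using b K by (auto intro!: carrier_matI)
  have "x i (Suc k) - x 0 (Suc k) = A *\<^sub>v x i k + u i k \<cdot>\<^sub>v b - A *\<^sub>v x 0 k"
    using sys i unfolding leader_follower_system_def by simp
  also have "\<dots> = A *\<^sub>v ?e + u i k \<cdot>\<^sub>v b"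
    unfolding mult_minus_distrib_mat_vec[OF A xi x0] using A b x0 xi by (intro eq_vecI) auto
  also have "\<dots> = (A + b \<otimes>\<^sub>v K) *\<^sub>v ?e"
    using add_mult_distrib_mat_vec[OF A bK e] outer_mult_vec[OF K e] u by simp
  finally show ?thesis .
qed

lemma eventually_zero_of_nilpotent_recursion:
  assumes M: "M \<in> carrier_mat n n" and nil: "nilpotent_mat M"
    and e: "e S \<in> carrier_vec n" and rec: "\<And>k. k \<ge> S \<Longrightarrow> e (Suc k) = M *\<^sub>v e k"
  obtains T where "T > 0" "\<And>k. k \<ge> T \<Longrightarrow> e k = 0\<^sub>v n"
proof -
  obtain h where h: "h > 0" "\<And>k. k \<ge> h \<Longrightarrow> M ^\<^sub>m k = 0\<^sub>m n n"
    using nilpotent_mat_eventually_zero[OF M nil] by metis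
  have pow: "e (S + l) = M ^\<^sub>m l *\<^sub>v e S" for l
  proof (induction l)
    case 0
    then show ?case using M e by simp
  next
    case (Suc l)
    have "M ^\<^sub>m Suc l = M * M ^\<^sub>m l"
      using pow_mat_add[OF M, of 1 l] M by simp
    then show ?case
      using Suc rec[of "S + l"] assoc_mult_mat_vec[OF M pow_carrier_mat[OF M] e, of l] by simp
  qed
  have "e k = 0\<^sub>v n" if "k \<ge> S + h" for k
    using pow[of "k - S"] h(2)[of "k - S"] that e by (auto intro!: eq_vecI)
  then show thesis using h(1) by (intro that[of "S + h"]) auto
qed

text \<open>
  Information flows along the well-founded relation \<open>R\<close>, so agreement with the leader
  spreads by induction: after all predecessors have settled, the error of an agent evolves by the
  nilpotent closed-loop matrix alone. Arcs are required to lie in \<open>R\<close> only from time \<open>1\<close> on,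
  which suffices because consensus ignores any finite initial segment.
\<close>

lemma consensus_of_wf:
  fixes A :: "'a :: field mat"
  assumes A: "A \<in> carrier_mat n n" and b: "b \<in> carrier_vec n" and K: "K \<in> carrier_mat 1 n"
    and d: "d \<noteq> 0" and nil: "nilpotent_mat (A + b \<otimes>\<^sub>v K)"
    and wf: "wf R"
    and edge: "\<And>i j k. k \<ge> 1 \<Longrightarrow> i \<in> {1..N} \<Longrightarrow> j \<in> {1..N} \<Longrightarrow> w k i j \<noteq> 0 \<Longrightarrow> (j, i) \<in> R"
    and deg: "\<And>i k. i \<in> {1..N} \<Longrightarrow> (\<Sum>j = 0..N. w k i j) = d"
  shows "achieves_consensus n N A b ((- inverse d) \<cdot>\<^sub>m K) w"
  unfolding achieves_consensus_def
proof (intro allI impI, elim conjE)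
  fix x u
  assume sys: "leader_follower_system n N A b x u"
    and ctrl: "consensus_control n N ((- inverse d) \<cdot>\<^sub>m K) w x u"
  note car = leader_follower_system_carrier[OF sys A b]
  have M: "A + b \<otimes>\<^sub>v K \<in> carrier_mat n n" using A b K by (auto intro!: carrier_matI)
  have settle: "\<exists>T. \<forall>k\<ge>T. x i k = x 0 k" if "i \<in> {1..N}" for i
    using wf that
  proof (induction i rule: wf_induct_rule)
    case (less i)
    let ?P = "{j \<in> {1..N}. (j, i) \<in> R}"
    have "\<forall>j\<in>?P. \<exists>T. \<forall>k\<ge>T. x j k = x 0 k"
      using less.IH by blast
    then obtain T where T: "\<And>j k. j \<in> ?P \<Longrightarrow> k \<ge> T j \<Longrightarrow> x j k = x 0 k"
      by metis
    \<comment> \<open>The sum is a common bound for the \<open>T j\<close>; the successor skips time \<open>0\<close>, whose graph is not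
      part of the union.\<close>
    define S where "S = Suc (\<Sum>j\<in>?P. T j)"
    have agree: "x j k = x 0 k" if k: "k \<ge> S" and j: "j \<in> {0..N}" and w: "w k i j \<noteq> 0" for j k
    proof (cases "j = 0")
      case False
      then have jP: "j \<in> ?P"
        using edge[of k i j] k j w less.prems by (auto simp: S_def)
      then have "T j \<le> (\<Sum>j\<in>?P. T j)"
        by (intro member_le_sum) auto
      then show ?thesis using T[OF jP] k by (simp add: S_def)
    qed simp
    let ?e = "\<lambda>k. x i k - x 0 k"
    have "?e S \<in> carrier_vec n" using car less.prems by simp
    moreover have "?e (Suc k) = (A + b \<otimes>\<^sub>v K) *\<^sub>v ?e k" if "k \<ge> S" for k
      using error_step[OF A b K d sys ctrl less.prems deg[OF less.prems]] agree[OF that] by blast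
    ultimately obtain T' where T': "\<And>k. k \<ge> T' \<Longrightarrow> ?e k = 0\<^sub>v n"
      using eventually_zero_of_nilpotent_recursion[OF M nil, of ?e S] by metis
    have "x i k = x 0 k" if "k \<ge> T'" for k
    proof (rule eq_vecI)
      have xi: "x i k \<in> carrier_vec n" and x0: "x 0 k \<in> carrier_vec n"
        using car less.prems by auto
      show "dim_vec (x i k) = dim_vec (x 0 k)" using xi x0 by simp
      fix l assume "l < dim_vec (x 0 k)"
      then show "x i k $ l = x 0 k $ l"
        using T'[OF that] x0 by (metis carrier_vecD index_minus_vec(1) index_zero_vec(1) right_minus_eq)
    qed
    then show ?case by blast
  qed
  then obtain T where T: "\<And>i k. i \<in> {1..N} \<Longrightarrow> k \<ge> T i \<Longrightarrow> x i k = x 0 k"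
    by metis
  show "\<exists>T>0. \<forall>i\<in>{1..N}. \<forall>k\<ge>T. x i k = x 0 k"
  proof (intro exI[of _ "Suc (\<Sum>i\<in>{1..N}. T i)"] conjI ballI allI impI)
    fix i k assume i: "i \<in> {1..N}" and k: "k \<ge> Suc (\<Sum>i\<in>{1..N}. T i)"
    have "T i \<le> (\<Sum>i\<in>{1..N}. T i)" using i by (intro member_le_sum) auto
    then show "x i k = x 0 k" using T[OF i] k by simp
  qed simp
qed

section \<open>Consensus over switching acyclic graphs\<close>

theorem mainTheorem2:
  fixes A :: "'p :: prime_card mod_ring mat"
    and b :: "'p mod_ring vec"
    and n N q d :: nat
    and G :: "nat \<Rightarrow> nat pair_pre_digraph"
    and a :: "nat \<Rightarrow> nat \<Rightarrow> nat \<Rightarrow> 'p mod_ring"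
  assumes "n \<ge> 1" and "N \<ge> 1" and "q \<ge> 1"
    and "A \<in> carrier_mat n n" and "b \<in> carrier_vec n"
    and "\<And>r. r \<in> {1..q} \<Longrightarrow> weighted_digraph_on N (G r) (a r)"
    and "\<not> nilpotent_mat A"
    and "stabilizable n A b"
    and "d \<in> {1..CARD('p) - 1}"
  shows "\<exists>K \<in> carrier_mat 1 n. \<forall>\<sigma> :: nat \<Rightarrow> nat.
           (\<forall>k. \<sigma> k \<in> {1..q}) \<longrightarrow>
           directed_acyclic (follower_union N G \<sigma>) \<longrightarrow>
           (\<forall>i\<in>{1..N}. \<forall>k. (\<Sum>j = 0..N. a (\<sigma> k) i j) = of_nat d) \<longrightarrow>
           achieves_consensus n N A b K (\<lambda>k. a (\<sigma> k))"
proof -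
  note A = assms(4) and b = assms(5)
  have d: "of_nat d \<noteq> (0 :: 'p mod_ring)"
  proof
    assume "of_nat d = (0 :: 'p mod_ring)"
    then have "CARD('p) \<le> d"
      using of_nat_0_mod_ring_dvd[of d] assms(9) by (intro dvd_imp_le) auto
    moreover have "CARD('p) > 0" by simp
    ultimately show False using assms(9) by auto
  qed
  obtain K where K: "K \<in> carrier_mat 1 n" and nil: "nilpotent_mat (A + b \<otimes>\<^sub>v K)"
    using stabilizable_imp_nilpotent_feedback[OF A b assms(8)] by metis
  show ?thesis
  proof (intro bexI[of _ "(- inverse (of_nat d)) \<cdot>\<^sub>m K"] allI impI)
    fix \<sigma> :: "nat \<Rightarrow> nat"
    assume \<sigma>: "\<forall>k. \<sigma> k \<in> {1..q}" and dag: "directed_acyclic (follower_union N G \<sigma>)"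
      and deg: "\<forall>i\<in>{1..N}. \<forall>k. (\<Sum>j = 0..N. a (\<sigma> k) i j) = of_nat d"
    let ?R = "arcs (follower_union N G \<sigma>)"
    have "?R \<subseteq> {1..N} \<times> {1..N}"
      unfolding arcs_follower_union by blast
    then have "finite ?R" by (rule finite_subset) simp
    then have wf: "wf ?R"
      using directed_acyclic_imp_wf[OF dag] by (simp add: arcs_ends_follower_union)
    have edge: "(j, i) \<in> ?R"
      if "k \<ge> 1" "i \<in> {1..N}" "j \<in> {1..N}" "a (\<sigma> k) i j \<noteq> 0" for i j k
    proof -
      have "weighted_digraph_on N (G (\<sigma> k)) (a (\<sigma> k))"
        using assms(6) \<sigma> by blast
      moreover have "i \<in> {0..N}" "j \<in> {0..N}" using that by auto
      ultimately have "(j, i) \<in> parcs (G (\<sigma> k))"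
        using that(4) unfolding weighted_digraph_on_def by blast
      then show ?thesis
        unfolding arcs_follower_union using that by blast
    qed
    show "achieves_consensus n N A b ((- inverse (of_nat d)) \<cdot>\<^sub>m K) (\<lambda>k. a (\<sigma> k))"
      by (rule consensus_of_wf[OF A b K d nil wf]) (use edge deg in auto)
  qed (use K in simp)
qed

end
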